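(* If $S\subset\mathbb{R}^n$ is an open set, then its orthogonally convex hull $\operatorname{ortho-hull}(S)$ is open.
   Context: An axis-aligned line in $\mathbb{R}^n$ is a line parallel to one of the coordinate axes. A set $S\subset\mathbb{R}^n$ is ortho-convex if its intersection with every axis-aligned line is connected (possibly empty). The orthogonally convex hull $\operatorname{ortho-hull}(S)$ of a set $S\subset\mathbb{R}^n$ is the intersection of all ortho-convex subsets of $\mathbb{R}^n$ containing $S$. *)

theory Defs
  imports "HOL-Analysis.Analysis"
begin

definition axis_aligned_line :: "(real ^ 'n) set \<Rightarrow> bool" where
  "axis_aligned_line L \<longleftrightarrow> (\<exists>p i. L = range (\<lambda>t. p + t *\<^sub>R axis i 1))"

(* The library's "connected" holds of the empty set. *)
definition ortho_convex :: "(real ^ 'n) set \<Rightarrow> bool" where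
  "ortho_convex S \<longleftrightarrow> (\<forall>L. axis_aligned_line L \<longrightarrow> connected (S \<inter> L))"

definition ortho_hull :: "(real ^ 'n) set \<Rightarrow> (real ^ 'n) set" where
  "ortho_hull S = ortho_convex hull S"

end

theory Submission
  imports Defs
begin

text \<open>
  On a line, connected and convex mean the same, so ortho-convexity says that \<open>S\<close> meets every
  axis-aligned line in a convex set. In this form the property visibly survives arbitrary
  intersections, which makes the hull itself ortho-convex. It also survives taking interiors: if
  \<open>x\<close> and \<open>y\<close> on an axis-aligned line \<open>L\<close> are each surrounded by an \<open>e\<close>-ball inside \<open>T\<close>, then for every
  vector \<open>w\<close> with \<open>norm w < e\<close> the points \<open>x + w\<close> and \<open>y + w\<close> lie in \<open>T\<close> and on the translate of \<open>L\<close> by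
  \<open>w\<close>, which is axis-aligned again; hence the whole segment, moved by \<open>w\<close>, lies in \<open>T\<close>.

  For open \<open>S\<close>, the interior of the hull is therefore an ortho-convex set containing \<open>S\<close>. By minimality
  it contains the hull, so the hull equals its interior.
\<close>

lemma convex_axis_aligned_line:
  assumes "axis_aligned_line L"
  shows "convex L"
proof -
  obtain p i where L: "L = range (\<lambda>t. p + t *\<^sub>R axis i 1)"
    using assms unfolding axis_aligned_line_def by blast
  have "L = (+) p ` span {axis i 1}"
    unfolding L span_singleton by auto
  then show ?thesis
    by (simp add: convex_translation subspace_imp_convex)
qed

lemma collinear_axis_aligned_line:
  assumes "axis_aligned_line L"
  shows "collinear L"
proof -
  obtain p i where L: "L = range (\<lambda>t. p + t *\<^sub>R axis i 1)"
    using assms unfolding axis_aligned_line_def by blast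
  have "\<exists>c. x - y = c *\<^sub>R axis i 1" if "x \<in> L" "y \<in> L" for x y
    using that unfolding L by (auto simp flip: scaleR_diff_left)
  then show ?thesis
    unfolding collinear_def by blast
qed

lemma axis_aligned_line_translation:
  assumes "axis_aligned_line L"
  shows "axis_aligned_line ((+) w ` L)"
proof -
  obtain p i where L: "L = range (\<lambda>t. p + t *\<^sub>R axis i 1)"
    using assms unfolding axis_aligned_line_def by blast
  have "(+) w ` L = range (\<lambda>t. (w + p) + t *\<^sub>R axis i 1)"
    unfolding L by (simp add: image_image add.assoc)
  then show ?thesis
    unfolding axis_aligned_line_def by blast
qed

lemma ortho_convex_iff_convex_sections:
  "ortho_convex S \<longleftrightarrow> (\<forall>L. axis_aligned_line L \<longrightarrow> convex (S \<inter> L))"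
proof -
  have "connected (S \<inter> L) \<longleftrightarrow> convex (S \<inter> L)" if "axis_aligned_line L" for L
    using collinear_subset[OF collinear_axis_aligned_line[OF that]]
    by (metis convex_connected_collinear Int_lower2)
  then show ?thesis
    unfolding ortho_convex_def by blast
qed

text \<open>
  A section of the intersection is the intersection of the sections, and convexity survives
  intersections, whereas connectedness in general does not. For the empty family the section is the
  whole line, so the line has to be convex too.
\<close>

lemma ortho_convex_Inter:
  fixes F :: "(real ^ 'n) set set"
  assumes "\<And>T. T \<in> F \<Longrightarrow> ortho_convex T"
  shows "ortho_convex (\<Inter>F)"
  unfolding ortho_convex_iff_convex_sections
proof (intro allI impI)
  fix L :: "(real ^ 'n) set"
  assume L: "axis_aligned_line L"
  have "convex (T \<inter> L)" if "T \<in> F" for T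
    using assms[OF that] L by (simp add: ortho_convex_iff_convex_sections)
  then have "convex (L \<inter> (\<Inter>T\<in>F. T \<inter> L))"
    using convex_axis_aligned_line[OF L] by (blast intro: convex_Int convex_INT)
  moreover have "\<Inter>F \<inter> L = L \<inter> (\<Inter>T\<in>F. T \<inter> L)"
    by blast
  ultimately show "convex (\<Inter>F \<inter> L)"
    by simp
qed

lemma ortho_convex_ortho_hull: "ortho_convex (ortho_hull S)"
  unfolding ortho_hull_def by (rule hull_in) (blast intro: ortho_convex_Inter)

text \<open>
  A segment along an axis can be moved by any small vector without leaving \<open>T\<close>, because its moved
  endpoints stay in \<open>T\<close> and still span a segment along the same axis.
\<close>

lemma ortho_convex_interior:
  fixes T :: "(real ^ 'n) set"
  assumes "ortho_convex T"
  shows "ortho_convex (interior T)"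
  unfolding ortho_convex_iff_convex_sections
proof (intro allI impI)
  fix L :: "(real ^ 'n) set"
  assume L: "axis_aligned_line L"
  show "convex (interior T \<inter> L)"
    unfolding convex_contains_segment
  proof (intro ballI subsetI IntI)
    fix x y z
    assume x: "x \<in> interior T \<inter> L" and y: "y \<in> interior T \<inter> L"
      and z: "z \<in> closed_segment x y"
    show "z \<in> L"
      using convex_axis_aligned_line[OF L] x y z
      by (auto simp: convex_contains_segment)
    obtain d where d: "0 < d" "ball x d \<subseteq> T"
      using x by (auto simp: mem_interior)
    obtain e where e: "0 < e" "ball y e \<subseteq> T"
      using y by (auto simp: mem_interior)
    have "ball z (min d e) \<subseteq> T"
    proof
      fix v
      assume v: "v \<in> ball z (min d e)"
      define w where "w = v - z"
      have w: "norm w < d" "norm w < e"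
        using v by (auto simp: w_def dist_norm norm_minus_commute)
      have "w + x \<in> T" "w + y \<in> T"
        using d e w by (auto simp: subset_eq dist_norm)
      moreover have "convex (T \<inter> (+) w ` L)"
        using assms axis_aligned_line_translation[OF L]
        by (auto simp: ortho_convex_iff_convex_sections)
      ultimately have "closed_segment (w + x) (w + y) \<subseteq> T"
        using x y by (auto simp: convex_contains_segment)
      moreover have "w + z \<in> closed_segment (w + x) (w + y)"
        using z by (simp add: closed_segment_translation)
      ultimately show "v \<in> T"
        by (auto simp: w_def)
    qed
    then show "z \<in> interior T"
      using d e by (auto simp: mem_interior intro!: exI[of _ "min d e"])
  qed
qed

theorem theorem4:
  fixes S :: "(real ^ 'n) set"
  assumes "open S"
  shows "open (ortho_hull S)"
proof -
  have "S \<subseteq> ortho_hull S"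
    unfolding ortho_hull_def by (rule hull_subset)
  then have "S \<subseteq> interior (ortho_hull S)"
    using assms by (rule interior_maximal)
  moreover have "ortho_convex (interior (ortho_hull S))"
    by (intro ortho_convex_interior ortho_convex_ortho_hull)
  ultimately have "ortho_hull S \<subseteq> interior (ortho_hull S)"
    unfolding ortho_hull_def[of S] by (rule hull_minimal)
  then show ?thesis
    using interior_subset[of "ortho_hull S"] open_interior[of "ortho_hull S"]
    by (simp add: subset_antisym)
qed

end
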